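(* For every $f\in L^{1}(\mathbb{R})\cap L^{2}(\mathbb{R})$ the inequality $$\min_{t\in[-1/2,1/2]}\int_{\mathbb{R}}f(x)f(x+t)\,dx\leq 0.829604\,\|f\|_1\|f\|_2$$ holds. Moreover, the constant $0.829604$ cannot be replaced by $0.544$ (that is, the inequality with $0.544$ in place of $0.829604$ fails for some $f\in L^{1}(\mathbb{R})\cap L^{2}(\mathbb{R})$).
   Context: Functions are real-valued, $f:\mathbb{R}\to\mathbb{R}$, and $\|f\|_p$ denotes the $L^p(\mathbb{R})$ norm with respect to Lebesgue measure. *)

theory Defs
  imports "HOL-Analysis.Analysis"
begin

definition Lp :: "real \<Rightarrow> (real \<Rightarrow> real) set" where
  "Lp p = {f. f \<in> borel_measurable lebesgue \<and> integrable lebesgue (\<lambda>x. \<bar>f x\<bar> powr p)}"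

definition Lp_norm :: "real \<Rightarrow> (real \<Rightarrow> real) \<Rightarrow> real" where
  "Lp_norm p f = (LINT x|lebesgue. \<bar>f x\<bar> powr p) powr (1 / p)"

definition autocorr :: "(real \<Rightarrow> real) \<Rightarrow> real \<Rightarrow> real" where
  "autocorr f t = (LINT x|lebesgue. f x * f (x + t))"

text \<open>\<open>is_min_on g S m\<close>: the minimum of \<open>g\<close> over \<open>S\<close> exists (it is attained) and equals \<open>m\<close>.
  The library's \<open>Min\<close> only covers finite sets, and \<open>Inf\<close> would not express attainment.\<close>

definition is_min_on :: "('a \<Rightarrow> real) \<Rightarrow> 'a set \<Rightarrow> real \<Rightarrow> bool" where
  "is_min_on g S m \<longleftrightarrow> m \<in> g ` S \<and> (\<forall>s\<in>S. m \<le> g s)"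

end

theory Submission
  imports Defs
begin

text \<open>For the upper bound one may assume \<open>f \<ge> 0\<close>. Let \<open>g\<close> be the autocorrelation of \<open>f\<close>, let
  \<open>A = \<parallel>f\<parallel>\<^sub>2\<^sup>2\<close>, \<open>B = \<parallel>f\<parallel>\<^sub>1\<^sup>2\<close>, and suppose \<open>g \<ge> m\<close> on \<open>[-1/2, 1/2]\<close>. For an even weight \<open>\<eta> \<ge> 0\<close> of mass 1
  supported in \<open>[-1/2, 1/2]\<close>, expanding \<open>\<parallel>a f - f \<star> \<eta>\<parallel>\<^sub>2\<^sup>2 \<ge> 0\<close> gives
  \<open>2 a \<integral> g \<eta> \<le> a\<^sup>2 A + \<integral> g (\<eta> \<star> \<eta>)\<close>. Taking \<open>\<eta>\<close> heavier near the endpoints than near the centre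
  makes \<open>\<eta> \<star> \<eta> \<le> 4/9\<close> outside \<open>[-1/2, 1/2]\<close>, while on this interval \<open>\<eta> \<star> \<eta>\<close> has integral \<open>2/3\<close>.
  Since \<open>\<integral> g = B\<close>, this yields \<open>m (2 a - 2/9) \<le> a\<^sup>2 A + 4/9 B\<close>, and \<open>a = m / A\<close> together with
  \<open>m \<le> B\<close> gives \<open>m\<^sup>2 \<le> 2/3 A B\<close>. The minimum is attained because \<open>g\<close> is continuous, and the
  indicator of an interval of length \<open>3/2\<close> has minimum 1 and shows that \<open>0.544\<close> is too small.\<close>

subsection \<open>Smoothing in Lebesgue integrals of nonnegative functions\<close>

lemma nn_integral_lborel_shift:
  fixes h :: "real \<Rightarrow> ennreal"
  assumes "h \<in> borel_measurable borel"
  shows "(\<integral>\<^sup>+x. h (x + t) \<partial>lborel) = (\<integral>\<^sup>+x. h x \<partial>lborel)"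
  using nn_integral_real_affine[OF assms, of 1 t] by (simp add: add.commute)

lemma nn_integral_lborel_swap:
  fixes h :: "real \<Rightarrow> real \<Rightarrow> ennreal"
  assumes "(\<lambda>(x, y). h x y) \<in> borel_measurable (lborel \<Otimes>\<^sub>M lborel)"
  shows "(\<integral>\<^sup>+x. \<integral>\<^sup>+y. h x y \<partial>lborel \<partial>lborel) = (\<integral>\<^sup>+y. \<integral>\<^sup>+x. h x y \<partial>lborel \<partial>lborel)"
  using lborel_pair.Fubini'[OF assms] by simp

lemma ennreal_AM_GM:
  fixes a x y :: ennreal
  shows "2 * a * x * y \<le> a\<^sup>2 * x\<^sup>2 + y\<^sup>2"
proof -
  have *: "2 * p * y \<le> p\<^sup>2 + y\<^sup>2" for p :: ennreal
  proof (cases p; cases y)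
    fix r s :: real
    assume "p = ennreal r" "0 \<le> r" "y = ennreal s" "0 \<le> s"
    then have "2 * p * y = ennreal (2 * r * s)" "p\<^sup>2 + y\<^sup>2 = ennreal (r\<^sup>2 + s\<^sup>2)"
      by (simp_all add: ennreal_mult ennreal_power ennreal_plus)
    then show ?thesis
      using sum_squares_bound[of r s] by (simp add: ennreal_leI del: ennreal_plus flip: ennreal_plus)
  qed (auto simp: power2_eq_square ennreal_top_mult)
  show ?thesis
    using *[of "a * x"] by (simp add: power_mult_distrib mult_ac)
qed

text \<open>Tonelli and translation invariance; applied to \<open>f\<close> it yields both
  integrability of the autocorrelation and its total mass \<open>B\<close>.\<close>

lemma nn_integral_autocorr:
  fixes \<phi> :: "real \<Rightarrow> ennreal"
  assumes [measurable]: "\<phi> \<in> borel_measurable borel"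
  shows "(\<integral>\<^sup>+t. \<integral>\<^sup>+x. \<phi> x * \<phi> (x + t) \<partial>lborel \<partial>lborel) = (\<integral>\<^sup>+x. \<phi> x \<partial>lborel)\<^sup>2"
proof -
  have "(\<integral>\<^sup>+t. \<integral>\<^sup>+x. \<phi> x * \<phi> (x + t) \<partial>lborel \<partial>lborel)
      = (\<integral>\<^sup>+x. \<integral>\<^sup>+t. \<phi> x * \<phi> (t + x) \<partial>lborel \<partial>lborel)"
    by (subst nn_integral_lborel_swap) (simp_all add: add.commute)
  also have "\<dots> = (\<integral>\<^sup>+x. \<phi> x * (\<integral>\<^sup>+t. \<phi> t \<partial>lborel) \<partial>lborel)"
    by (intro nn_integral_cong) (simp add: nn_integral_cmult nn_integral_lborel_shift)
  also have "\<dots> = (\<integral>\<^sup>+x. \<phi> x \<partial>lborel)\<^sup>2"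
    by (simp add: nn_integral_multc power2_eq_square)
  finally show ?thesis .
qed

context
  fixes \<phi> E :: "real \<Rightarrow> ennreal"
  assumes \<phi> [measurable]: "\<phi> \<in> borel_measurable borel"
    and E [measurable]: "E \<in> borel_measurable borel"
begin

text \<open>The cross term of the expanded square. The smoothing is written as a correlation with
  \<open>E\<close>, which for an even weight is the convolution.\<close>

lemma nn_integral_smoothing_pairing:
  "(\<integral>\<^sup>+x. \<phi> x * (\<integral>\<^sup>+t. \<phi> (x + t) * E t \<partial>lborel) \<partial>lborel)
    = (\<integral>\<^sup>+t. (\<integral>\<^sup>+x. \<phi> x * \<phi> (x + t) \<partial>lborel) * E t \<partial>lborel)"
proof -
  have "(\<integral>\<^sup>+x. \<phi> x * (\<integral>\<^sup>+t. \<phi> (x + t) * E t \<partial>lborel) \<partial>lborel)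
    = (\<integral>\<^sup>+x. \<integral>\<^sup>+t. \<phi> x * \<phi> (x + t) * E t \<partial>lborel \<partial>lborel)"
    by (intro nn_integral_cong) (simp add: nn_integral_cmult[symmetric] mult.assoc)
  also have "\<dots> = (\<integral>\<^sup>+t. \<integral>\<^sup>+x. \<phi> x * \<phi> (x + t) * E t \<partial>lborel \<partial>lborel)"
    by (subst nn_integral_lborel_swap) simp_all
  also have "\<dots> = (\<integral>\<^sup>+t. (\<integral>\<^sup>+x. \<phi> x * \<phi> (x + t) \<partial>lborel) * E t \<partial>lborel)"
    by (intro nn_integral_cong) (simp add: nn_integral_multc)
  finally show ?thesis .
qed

text \<open>Write the square as a double integral over \<open>s\<close>, \<open>t\<close> and
  substitute \<open>t = u + s\<close>. Integrating out \<open>x\<close> first leaves the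
  autocorrelation of \<open>\<phi>\<close> at \<open>u\<close>, by translation invariance;
  integrating out \<open>s\<close> leaves that of \<open>E\<close>.\<close>

lemma nn_integral_smoothing_square:
  "(\<integral>\<^sup>+x. (\<integral>\<^sup>+t. \<phi> (x + t) * E t \<partial>lborel)\<^sup>2 \<partial>lborel)
    = (\<integral>\<^sup>+u. (\<integral>\<^sup>+x. \<phi> x * \<phi> (x + u) \<partial>lborel) * (\<integral>\<^sup>+s. E s * E (s + u) \<partial>lborel) \<partial>lborel)"
proof -
  define G where "G u = (\<integral>\<^sup>+x. \<phi> x * \<phi> (x + u) \<partial>lborel)" for u
  have G [measurable]: "G \<in> borel_measurable borel"
    unfolding G_def by measurable
  have shift: "(\<integral>\<^sup>+x. \<phi> (x + s) * \<phi> (x + (u + s)) \<partial>lborel) = G u" for s u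
    using nn_integral_lborel_shift[of "\<lambda>x. \<phi> x * \<phi> (x + u)" s]
    by (simp add: G_def add_ac)
  have "(\<integral>\<^sup>+x. (\<integral>\<^sup>+t. \<phi> (x + t) * E t \<partial>lborel)\<^sup>2 \<partial>lborel)
    = (\<integral>\<^sup>+x. \<integral>\<^sup>+s. \<integral>\<^sup>+t. (\<phi> (x + s) * E s) * (\<phi> (x + t) * E t) \<partial>lborel \<partial>lborel \<partial>lborel)"
    by (simp add: nn_integral_cmult nn_integral_multc power2_eq_square)
  also have "\<dots> = (\<integral>\<^sup>+x. \<integral>\<^sup>+s. \<integral>\<^sup>+u. (\<phi> (x + s) * E s) * (\<phi> (x + (u + s)) * E (u + s)) \<partial>lborel \<partial>lborel \<partial>lborel)"
    by (rule nn_integral_cong, rule nn_integral_cong, rule nn_integral_lborel_shift[symmetric]) measurable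
  also have "\<dots> = (\<integral>\<^sup>+s. \<integral>\<^sup>+x. \<integral>\<^sup>+u. (\<phi> (x + s) * E s) * (\<phi> (x + (u + s)) * E (u + s)) \<partial>lborel \<partial>lborel \<partial>lborel)"
    by (rule nn_integral_lborel_swap) measurable
  also have "\<dots> = (\<integral>\<^sup>+s. \<integral>\<^sup>+u. \<integral>\<^sup>+x. (\<phi> (x + s) * E s) * (\<phi> (x + (u + s)) * E (u + s)) \<partial>lborel \<partial>lborel \<partial>lborel)"
    by (intro nn_integral_cong nn_integral_lborel_swap) measurable
  also have "\<dots> = (\<integral>\<^sup>+s. \<integral>\<^sup>+u. \<integral>\<^sup>+x. (\<phi> (x + s) * \<phi> (x + (u + s))) * (E s * E (s + u)) \<partial>lborel \<partial>lborel \<partial>lborel)"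
    by (intro nn_integral_cong) (simp add: mult_ac add_ac)
  also have "\<dots> = (\<integral>\<^sup>+s. \<integral>\<^sup>+u. G u * (E s * E (s + u)) \<partial>lborel \<partial>lborel)"
    by (simp add: nn_integral_multc shift)
  also have "\<dots> = (\<integral>\<^sup>+u. \<integral>\<^sup>+s. G u * (E s * E (s + u)) \<partial>lborel \<partial>lborel)"
    by (rule nn_integral_lborel_swap) measurable
  also have "\<dots> = (\<integral>\<^sup>+u. G u * (\<integral>\<^sup>+s. E s * E (s + u) \<partial>lborel) \<partial>lborel)"
    by (simp add: nn_integral_cmult)
  finally show ?thesis
    by (simp add: G_def)
qed

lemma smoothing_inequality:
  "2 * a * (\<integral>\<^sup>+t. (\<integral>\<^sup>+x. \<phi> x * \<phi> (x + t) \<partial>lborel) * E t \<partial>lborel)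
    \<le> a\<^sup>2 * (\<integral>\<^sup>+x. (\<phi> x)\<^sup>2 \<partial>lborel)
      + (\<integral>\<^sup>+u. (\<integral>\<^sup>+x. \<phi> x * \<phi> (x + u) \<partial>lborel) * (\<integral>\<^sup>+s. E s * E (s + u) \<partial>lborel) \<partial>lborel)"
proof -
  define F where "F x = (\<integral>\<^sup>+t. \<phi> (x + t) * E t \<partial>lborel)" for x
  have [measurable]: "F \<in> borel_measurable borel"
    unfolding F_def by measurable
  have "2 * a * (\<integral>\<^sup>+x. \<phi> x * F x \<partial>lborel) = (\<integral>\<^sup>+x. 2 * a * \<phi> x * F x \<partial>lborel)"
    by (simp add: nn_integral_cmult[symmetric] mult.assoc)
  also have "\<dots> \<le> (\<integral>\<^sup>+x. a\<^sup>2 * (\<phi> x)\<^sup>2 + (F x)\<^sup>2 \<partial>lborel)"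
    by (intro nn_integral_mono ennreal_AM_GM)
  also have "\<dots> = a\<^sup>2 * (\<integral>\<^sup>+x. (\<phi> x)\<^sup>2 \<partial>lborel) + (\<integral>\<^sup>+x. (F x)\<^sup>2 \<partial>lborel)"
    by (simp add: nn_integral_add nn_integral_cmult)
  finally show ?thesis
    unfolding F_def nn_integral_smoothing_pairing nn_integral_smoothing_square .
qed

end

subsection \<open>The weight and its autocorrelation\<close>

text \<open>The weight \<open>\<eta>\<close>. Among two-level weights, the ratio \<open>2\<close> of the outer to the central height makes
  \<open>\<eta> \<star> \<eta>\<close> constant on \<open>[1/2, 3/4]\<close>.\<close>

definition kern :: "real \<Rightarrow> real" where
  "kern s = 4/3 * indicator {-(1/2)..1/2} s - 2/3 * indicator {-(1/4)..1/4} s"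

definition tent :: "real \<Rightarrow> real \<Rightarrow> real" where
  "tent c u = max 0 (c - \<bar>u\<bar>)"

lemma kern_nonneg: "0 \<le> kern s"
  by (auto simp: kern_def indicator_def)

lemma kern_measurable [measurable]: "kern \<in> borel_measurable borel"
  unfolding kern_def by measurable

lemma tent_measurable [measurable]: "tent c \<in> borel_measurable borel"
  unfolding tent_def by measurable

text \<open>The integrand is the indicator of an intersection of two intervals; \<open>max 0\<close>
  accounts for an empty intersection.\<close>

lemma has_bochner_integral_overlap:
  fixes a b u :: real
  shows "has_bochner_integral lborel (\<lambda>s. indicator {-a..a} s * indicator {-b..b} (s + u))
    (max 0 (min a (b - u) - max (-a) (-b - u)))"
proof -
  have "(\<lambda>s. indicator {-a..a} s * indicator {-b..b} (s + u) :: real)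
      = indicator {max (-a) (-b - u)..min a (b - u)}"
    by (auto simp: indicator_def fun_eq_iff)
  moreover have "has_bochner_integral lborel (indicator {max (-a) (-b - u)..min a (b - u)} :: real \<Rightarrow> real)
      (measure lborel {max (-a) (-b - u)..min a (b - u)})"
    by (rule has_bochner_integral_real_indicator) (auto simp: emeasure_lborel_Icc_eq)
  ultimately show ?thesis
    by (auto simp: max_def split: if_splits)
qed

text \<open>Equality holds for \<open>\<bar>u\<bar> \<le> 3/4\<close>; beyond that the left side
  decreases to 0 while the right side stays at 4/9. The right side separates a constant, which costs
  \<open>4/9 * B\<close> against the autocorrelation of \<open>f\<close>, from tents supported in
  [-1/2, 1/2].\<close>

lemma kern_autocorr_le:
  "(\<integral>\<^sup>+s. ennreal (kern s) * ennreal (kern (s + u)) \<partial>lborel)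
    \<le> ennreal (4/9 * (1 + tent (1/2) u + 4 * tent (1/4) u))"
proof -
  let ?o = "\<lambda>a b. max 0 (min a (b - u) - max (-a) (-b - u))"
  \<comment> \<open>The product of the two weights is multiplied out: 16/9, 8/9 and 4/9 are the
    products of the heights 4/3 and 2/3.\<close>
  have "has_bochner_integral lborel (\<lambda>s.
       16/9 * (indicator {-(1/2)..1/2} s * indicator {-(1/2)..1/2} (s + u))
       - 8/9 * (indicator {-(1/2)..1/2} s * indicator {-(1/4)..1/4} (s + u))
       - 8/9 * (indicator {-(1/4)..1/4} s * indicator {-(1/2)..1/2} (s + u))
       + 4/9 * (indicator {-(1/4)..1/4} s * indicator {-(1/4)..1/4} (s + u)))
     (16/9 * ?o (1/2) (1/2) - 8/9 * ?o (1/2) (1/4) - 8/9 * ?o (1/4) (1/2) + 4/9 * ?o (1/4) (1/4))"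
    by (intro has_bochner_integral_add has_bochner_integral_diff has_bochner_integral_mult_right
        has_bochner_integral_overlap)
  also have "(\<lambda>s.
       16/9 * (indicator {-(1/2)..1/2} s * indicator {-(1/2)..1/2} (s + u))
       - 8/9 * (indicator {-(1/2)..1/2} s * indicator {-(1/4)..1/4} (s + u))
       - 8/9 * (indicator {-(1/4)..1/4} s * indicator {-(1/2)..1/2} (s + u))
       + 4/9 * (indicator {-(1/4)..1/4} s * indicator {-(1/4)..1/4} (s + u)))
     = (\<lambda>s. kern s * kern (s + u))"
    by (simp add: kern_def fun_eq_iff algebra_simps)
  finally have *: "has_bochner_integral lborel (\<lambda>s. kern s * kern (s + u))
     (16/9 * ?o (1/2) (1/2) - 8/9 * ?o (1/2) (1/4) - 8/9 * ?o (1/4) (1/2) + 4/9 * ?o (1/4) (1/4))" .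
  have o1: "?o (1/2) (1/2) = max 0 (1 - \<bar>u\<bar>)" by (simp add: max_def min_def)
  have o2: "?o (1/2) (1/4) = max 0 (min (1/2) (3/4 - \<bar>u\<bar>))" by (auto simp: max_def min_def abs_if)
  have o3: "?o (1/4) (1/2) = max 0 (min (1/2) (3/4 - \<bar>u\<bar>))" by (auto simp: max_def min_def abs_if)
  have o4: "?o (1/4) (1/4) = max 0 (1/2 - \<bar>u\<bar>)" by (auto simp: max_def min_def abs_if)
  have "(\<integral>\<^sup>+s. ennreal (kern s) * ennreal (kern (s + u)) \<partial>lborel)
      = (\<integral>\<^sup>+s. ennreal (kern s * kern (s + u)) \<partial>lborel)"
    by (simp add: ennreal_mult kern_nonneg)
  also have "\<dots> = ennreal (LINT s|lborel. kern s * kern (s + u))"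
    using * by (intro nn_integral_eq_integral) (auto simp: kern_nonneg has_bochner_integral_iff)
  also have "\<dots> = ennreal (16/9 * max 0 (1 - \<bar>u\<bar>) - 16/9 * max 0 (min (1/2) (3/4 - \<bar>u\<bar>))
       + 4/9 * max 0 (1/2 - \<bar>u\<bar>))"
    using * unfolding o1 o2 o3 o4 by (simp add: has_bochner_integral_iff)
  also have "\<dots> \<le> ennreal (4/9 * (1 + tent (1/2) u + 4 * tent (1/4) u))"
    by (intro ennreal_leI) (auto simp: tent_def max_def min_def)
  finally show ?thesis .
qed

lemma kern_integral: "has_bochner_integral lborel kern 1"
proof -
  have *: "has_bochner_integral lborel (indicator {-c..c} :: real \<Rightarrow> real) (2 * c)" if "0 \<le> c" for c
    using has_bochner_integral_real_indicator[of "{-c..c}" lborel] that by simp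
  have "has_bochner_integral lborel kern (4/3 * (2 * (1/2)) - 2/3 * (2 * (1/4)))"
    unfolding kern_def
    by (intro has_bochner_integral_diff has_bochner_integral_mult_right *) auto
  then show ?thesis by simp
qed

lemma tent_integral:
  assumes "0 \<le> c"
  shows "integrable lborel (tent c)" "(LINT u|lborel. tent c u) \<le> c\<^sup>2"
proof -
  have 1: "has_bochner_integral lborel (\<lambda>x. (c - x) * indicator {0..c} x) ((c * c - c\<^sup>2/2) - (c * 0 - 0\<^sup>2/2))"
    by (rule has_bochner_integral_FTC_Icc_real) (use assms in \<open>auto intro!: derivative_eq_intros\<close>)
  have 2: "has_bochner_integral lborel (\<lambda>x. (c + x) * indicator {-c..0} x) ((c * 0 + 0\<^sup>2/2) - (c * (-c) + (-c)\<^sup>2/2))"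
    by (rule has_bochner_integral_FTC_Icc_real) (use assms in \<open>auto intro!: derivative_eq_intros\<close>)
  have 3: "has_bochner_integral lborel (\<lambda>x. (c - x) * indicator {0..c} x + (c + x) * indicator {-c..0} x) (c\<^sup>2)"
    using has_bochner_integral_add[OF 1 2] by (simp add: power2_eq_square)
  \<comment> \<open>Only an inequality: at \<open>x = 0\<close> both indicators are 1 and the right
    side is \<open>2 * c\<close>.\<close>
  have le: "tent c x \<le> (c - x) * indicator {0..c} x + (c + x) * indicator {-c..0} x" for x
    using assms by (auto simp: tent_def indicator_def)
  show int: "integrable lborel (tent c)"
    by (rule Bochner_Integration.integrable_bound[OF integrable.intros[OF 3]])
      (use le in \<open>auto simp: tent_def intro!: AE_I2 order_trans[OF _ abs_ge_self]\<close>)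
  show "(LINT u|lborel. tent c u) \<le> c\<^sup>2"
    using integral_mono[OF int integrable.intros[OF 3] le]
      has_bochner_integral_integral_eq[OF 3] by simp
qed

subsection \<open>The bound for nonnegative functions\<close>

text \<open>Two arguments, because the continuity proof approximates the first factor while keeping
  the second fixed.\<close>

definition corr :: "(real \<Rightarrow> real) \<Rightarrow> (real \<Rightarrow> real) \<Rightarrow> real \<Rightarrow> real" where
  "corr h f t = (LINT x|lborel. h x * f (x + t))"

lemma integrable_lborel_shift:
  fixes h :: "real \<Rightarrow> real"
  assumes "integrable lborel h"
  shows "integrable lborel (\<lambda>x. h (x + t))"
  using lborel_integrable_real_affine[OF assms, of 1 t] by (simp add: add.commute)

lemma integral_lborel_shift:
  fixes h :: "real \<Rightarrow> real"
  shows "(LINT x|lborel. h (x + t)) = (LINT x|lborel. h x)"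
  using lborel_integral_real_affine[of 1 h t] by (simp add: add.commute)

lemma integrable_mult_of_squares:
  fixes u v :: "'a \<Rightarrow> real"
  assumes [measurable]: "u \<in> borel_measurable M" "v \<in> borel_measurable M"
    and "integrable M (\<lambda>x. (u x)\<^sup>2)" "integrable M (\<lambda>x. (v x)\<^sup>2)"
  shows "integrable M (\<lambda>x. u x * v x)"
proof (rule Bochner_Integration.integrable_bound)
  show "integrable M (\<lambda>x. (u x)\<^sup>2 + (v x)\<^sup>2)"
    using assms by simp
  have "\<bar>u x * v x\<bar> \<le> (u x)\<^sup>2 + (v x)\<^sup>2" for x
  proof -
    have "2 * \<bar>u x * v x\<bar> \<le> (u x)\<^sup>2 + (v x)\<^sup>2"
      using sum_squares_bound[of "\<bar>u x\<bar>" "\<bar>v x\<bar>"] by (simp add: abs_mult mult.assoc)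
    then show ?thesis
      by simp
  qed
  then show "AE x in M. norm (u x * v x) \<le> norm ((u x)\<^sup>2 + (v x)\<^sup>2)"
    by simp
qed measurable

lemma corr_measurable [measurable]:
  assumes [measurable]: "h \<in> borel_measurable borel" "f \<in> borel_measurable borel"
  shows "corr h f \<in> borel_measurable borel"
proof -
  have "(\<lambda>t. LINT x|lborel. h x * f (x + t)) \<in> borel_measurable borel"
    by measurable
  then show ?thesis
    by (simp add: corr_def[abs_def])
qed

text \<open>The first bound integrates \<open>m \<le> g\<close> over an interval of length 1, using
  \<open>g \<ge> 0\<close> elsewhere. The second is the smoothing inequality with the parameter
  \<open>a\<close> still free.\<close>

lemma nonneg_autocorr_inequality:
  fixes f :: "real \<Rightarrow> real" and a m :: real
  assumes f [measurable]: "f \<in> borel_measurable borel"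
    and f0: "\<And>x. 0 \<le> f x"
    and f1: "integrable lborel f"
    and f2: "integrable lborel (\<lambda>x. (f x)\<^sup>2)"
    and m: "\<And>t. t \<in> {-1/2..1/2} \<Longrightarrow> m \<le> corr f f t"
  shows autocorr_min_le_L1: "m \<le> (LINT x|lborel. f x)\<^sup>2"
    and autocorr_min_quadratic: "1/2 \<le> a \<Longrightarrow>
      m * (2 * a - 2/9) \<le> a\<^sup>2 * (LINT x|lborel. (f x)\<^sup>2) + 4/9 * (LINT x|lborel. f x)\<^sup>2"
proof -
  define g where "g = corr f f"
  define B where "B = (LINT x|lborel. f x)\<^sup>2"
  have [measurable]: "g \<in> borel_measurable borel"
    unfolding g_def by measurable
  have g0: "0 \<le> g t" for t
    unfolding g_def corr_def using f0 by (intro integral_nonneg_AE) auto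
  have G: "(\<integral>\<^sup>+x. ennreal (f x) * ennreal (f (x + t)) \<partial>lborel) = ennreal (g t)" for t
  proof -
    have "integrable lborel (\<lambda>x. f x * f (x + t))"
      using f2 integrable_lborel_shift[OF f2, of t] by (intro integrable_mult_of_squares) auto
    then have "(\<integral>\<^sup>+x. ennreal (f x * f (x + t)) \<partial>lborel) = ennreal (g t)"
      unfolding g_def corr_def using f0 by (intro nn_integral_eq_integral) auto
    then show ?thesis
      using f0 by (simp add: ennreal_mult)
  qed
  have If: "(\<integral>\<^sup>+x. ennreal (f x) \<partial>lborel) = ennreal (LINT x|lborel. f x)"
    using f1 f0 by (intro nn_integral_eq_integral) auto
  have If2: "(\<integral>\<^sup>+x. (ennreal (f x))\<^sup>2 \<partial>lborel) = ennreal (LINT x|lborel. (f x)\<^sup>2)"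
    using f2 f0 by (subst nn_integral_eq_integral[symmetric]) (auto simp: ennreal_power)
  have IG: "(\<integral>\<^sup>+t. ennreal (g t) \<partial>lborel) = ennreal B"
    using nn_integral_autocorr[of "\<lambda>x. ennreal (f x)"] f0
    by (simp add: G If B_def ennreal_power integral_nonneg_AE)
  have g1: "integrable lborel g"
    using IG g0 by (intro integrableI_nn_integral_finite[where x = B]) auto
  have Ig: "(LINT t|lborel. g t) = B"
    using IG g0 by (simp add: integral_eq_nn_integral B_def)
  have gb: "integrable lborel (\<lambda>t. g t * w t)"
    if [measurable]: "w \<in> borel_measurable borel" and w: "\<And>t. \<bar>w t\<bar> \<le> K" for w K
  proof (rule Bochner_Integration.integrable_bound[OF integrable_mult_right[OF g1, of K]])
    have "\<bar>w t\<bar> * g t \<le> \<bar>K\<bar> * g t" for t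
      using g0 order_trans[OF w abs_ge_self] by (intro mult_right_mono)
    then show "AE t in lborel. norm (g t * w t) \<le> norm (K * g t)"
      using g0 by (simp add: abs_mult mult.commute)
  qed measurable
  have m_le: "m * w t \<le> g t * w t" if "0 \<le> w t" "\<bar>t\<bar> > 1/2 \<Longrightarrow> w t = 0" for w :: "real \<Rightarrow> real" and t
  proof (cases "\<bar>t\<bar> \<le> 1/2")
    case True
    then have "t \<in> {-1/2..1/2}" unfolding atLeastAtMost_iff by linarith
    then have "m \<le> g t" using m by (simp add: g_def)
    then show ?thesis using that by (intro mult_right_mono)
  qed (use that in simp)
  have ind: "has_bochner_integral lborel (indicator {-(1/2)..1/2} :: real \<Rightarrow> real) 1"
    using has_bochner_integral_real_indicator[of "{-(1/2)..1/2::real}" lborel] by simp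
  show "m \<le> (LINT x|lborel. f x)\<^sup>2"
  proof -
    have "m = (LINT t|lborel. m * indicator {-(1/2)..1/2::real} t)"
      using ind by (simp add: has_bochner_integral_iff)
    also have "\<dots> \<le> (LINT t|lborel. g t)"
    proof (rule integral_mono)
      show "m * indicator {-(1/2)..1/2} t \<le> g t" for t
        using m_le[of "indicator {-(1/2)..1/2}" t] g0[of t] by (auto simp: indicator_def split: if_splits)
      show "integrable lborel (\<lambda>t. m * indicator {-(1/2)..1/2::real} t)"
        using ind by (simp add: has_bochner_integral_iff)
    qed (rule g1)
    finally show ?thesis by (simp add: Ig B_def)
  qed
  assume a: "1/2 \<le> a"
  define e where "e u = tent (1/2) u + 4 * tent (1/4) u" for u
  have [measurable]: "e \<in> borel_measurable borel"
    unfolding e_def by measurable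
  have e: "0 \<le> e u" "\<bar>e u\<bar> \<le> 2" for u
    by (auto simp: e_def tent_def max_def)
  have k: "\<bar>kern u\<bar> \<le> 2" for u
    by (auto simp: kern_def indicator_def)
  have e1: "integrable lborel e" "(LINT u|lborel. e u) \<le> 1/2"
    using tent_integral[of "1/2"] tent_integral[of "1/4"] unfolding e_def
    by (auto simp: power2_eq_square)
  have gk: "integrable lborel (\<lambda>t. g t * kern t)" and ge: "integrable lborel (\<lambda>t. g t * e t)"
    by (rule gb[OF _ k], measurable) (rule gb[OF _ e(2)], measurable)
  \<comment> \<open>The smoothing inequality for \<open>E = kern\<close>, carried back to real
    integrals, which are finite by \<open>gk\<close> and \<open>ge\<close>.\<close>
  have "ennreal (2 * a * (LINT t|lborel. g t * kern t))
      = 2 * ennreal a * (\<integral>\<^sup>+t. ennreal (g t * kern t) \<partial>lborel)"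
    using a gk g0 kern_nonneg
    by (subst nn_integral_eq_integral) (auto simp: ennreal_mult)
  also have "\<dots> = 2 * ennreal a * (\<integral>\<^sup>+t. ennreal (g t) * ennreal (kern t) \<partial>lborel)"
    using g0 kern_nonneg by (simp add: ennreal_mult)
  also have "\<dots> \<le> (ennreal a)\<^sup>2 * ennreal (LINT x|lborel. (f x)\<^sup>2)
      + (\<integral>\<^sup>+u. ennreal (g u) * (\<integral>\<^sup>+s. ennreal (kern s) * ennreal (kern (s + u)) \<partial>lborel) \<partial>lborel)"
    using smoothing_inequality[of "\<lambda>x. ennreal (f x)" "\<lambda>x. ennreal (kern x)" "ennreal a"]
    by (simp add: G If2)
  also have "\<dots> \<le> (ennreal a)\<^sup>2 * ennreal (LINT x|lborel. (f x)\<^sup>2)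
      + (\<integral>\<^sup>+u. ennreal (g u * (4/9 * (1 + e u))) \<partial>lborel)"
  proof (intro add_left_mono nn_integral_mono)
    fix u
    show "ennreal (g u) * (\<integral>\<^sup>+s. ennreal (kern s) * ennreal (kern (s + u)) \<partial>lborel)
        \<le> ennreal (g u * (4/9 * (1 + e u)))"
      unfolding ennreal_mult'[OF g0] e_def
      using kern_autocorr_le[of u] by (intro mult_left_mono) (simp_all add: add.assoc)
  qed
  also have "(\<integral>\<^sup>+u. ennreal (g u * (4/9 * (1 + e u))) \<partial>lborel)
      = ennreal (LINT u|lborel. 4/9 * (g u + g u * e u))"
  proof -
    have "integrable lborel (\<lambda>u. 4/9 * (g u + g u * e u))"
      using g1 ge by simp
    moreover have "(\<lambda>u. 4/9 * (g u + g u * e u)) = (\<lambda>u. g u * (4/9 * (1 + e u)))"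
      by (simp add: algebra_simps)
    ultimately show ?thesis
      using g0 e(1) by (simp add: nn_integral_eq_integral)
  qed
  also have "(LINT u|lborel. 4/9 * (g u + g u * e u)) = 4/9 * (B + (LINT u|lborel. g u * e u))"
    using g1 ge by (simp add: Ig)
  also have "(ennreal a)\<^sup>2 * ennreal (LINT x|lborel. (f x)\<^sup>2) + ennreal (4/9 * (B + (LINT u|lborel. g u * e u)))
      = ennreal (a\<^sup>2 * (LINT x|lborel. (f x)\<^sup>2) + 4/9 * (B + (LINT u|lborel. g u * e u)))"
    using a g0 e(1) by (simp add: ennreal_power ennreal_mult integral_nonneg_AE B_def)
  finally have main: "2 * a * (LINT t|lborel. g t * kern t)
      \<le> a\<^sup>2 * (LINT x|lborel. (f x)\<^sup>2) + 4/9 * (B + (LINT u|lborel. g u * e u))"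
    using g0 e(1) by (subst (asm) ennreal_le_iff) (auto simp: integral_nonneg_AE B_def)
  \<comment> \<open>Moving the \<open>e\<close> term of \<open>main\<close> to the left leaves
    \<open>g\<close> integrated against \<open>W\<close>. Since \<open>W\<close> is nonnegative and
    lives on [-1/2, 1/2], the hypothesis on \<open>m\<close> applies under the integral.\<close>
  define W where "W t = 2 * a * kern t - 4/9 * e t" for t
  have W: "0 \<le> W t" "\<bar>t\<bar> > 1/2 \<Longrightarrow> W t = 0" for t
  proof -
    have "kern t \<le> 2 * a * kern t"
      using a kern_nonneg[of t] mult_right_mono[of 1 "2 * a" "kern t"] by simp
    \<comment> \<open>At \<open>t = 0\<close> both sides are 2/3, so \<open>a = 1/2\<close> is the
      least value with \<open>W \<ge> 0\<close>.\<close>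
    moreover have "4/9 * e t \<le> kern t"
      unfolding e_def kern_def tent_def indicator_def by (auto simp: max_def abs_if)
    ultimately show "0 \<le> W t" by (simp add: W_def)
    show "\<bar>t\<bar> > 1/2 \<Longrightarrow> W t = 0"
      by (auto simp: W_def e_def kern_def tent_def indicator_def)
  qed
  have gW: "(\<lambda>t. g t * W t) = (\<lambda>t. 2 * a * (g t * kern t) - 4/9 * (g t * e t))"
    by (simp add: W_def algebra_simps)
  have W1: "integrable lborel W" and IW: "(LINT t|lborel. W t) = 2 * a - 4/9 * (LINT u|lborel. e u)"
    using kern_integral e1 unfolding W_def by (auto simp: has_bochner_integral_iff)
  have "m * (LINT t|lborel. W t) = (LINT t|lborel. m * W t)"
    by simp
  also have "\<dots> \<le> (LINT t|lborel. g t * W t)"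
  proof (rule integral_mono)
    show "integrable lborel (\<lambda>t. m * W t)" "integrable lborel (\<lambda>t. g t * W t)"
      using W1 gk ge by (simp_all add: gW)
    show "m * W t \<le> g t * W t" for t
      by (rule m_le[of W, OF W])
  qed
  also have "\<dots> = 2 * a * (LINT t|lborel. g t * kern t) - 4/9 * (LINT t|lborel. g t * e t)"
    using gk ge by (simp add: gW)
  also have "\<dots> \<le> a\<^sup>2 * (LINT x|lborel. (f x)\<^sup>2) + 4/9 * B"
    using main unfolding distrib_left by linarith
  finally have *: "m * (LINT t|lborel. W t) \<le> a\<^sup>2 * (LINT x|lborel. (f x)\<^sup>2) + 4/9 * B" .
  show "m * (2 * a - 2/9) \<le> a\<^sup>2 * (LINT x|lborel. (f x)\<^sup>2) + 4/9 * (LINT x|lborel. f x)\<^sup>2"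
  \<comment> \<open>The mass of \<open>W\<close> is only known to be at least
    \<open>2 * a - 2/9\<close>, so multiplying by \<open>m\<close> needs its sign. For negative
    \<open>m\<close> the two sides of the claim have opposite signs.\<close>
  proof (cases "0 \<le> m")
    case True
    then have "m * (2 * a - 2/9) \<le> m * (LINT t|lborel. W t)"
      using e1(2) by (intro mult_left_mono) (auto simp: IW)
    with * show ?thesis by (simp add: B_def)
  next
    case False
    then have "m * (2 * a - 2/9) \<le> 0"
      using a by (intro mult_nonpos_nonneg) auto
    also have "0 \<le> a\<^sup>2 * (LINT x|lborel. (f x)\<^sup>2) + 4/9 * (LINT x|lborel. f x)\<^sup>2"
      by (intro add_nonneg_nonneg mult_nonneg_nonneg integral_nonneg_AE) auto
    finally show ?thesis .
  qed
qed

lemma nonneg_autocorr_min_le: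
  fixes f :: "real \<Rightarrow> real" and m :: real
  assumes f [measurable]: "f \<in> borel_measurable borel"
    and f0: "\<And>x. 0 \<le> f x"
    and f1: "integrable lborel f"
    and f2: "integrable lborel (\<lambda>x. (f x)\<^sup>2)"
    and m: "\<And>t. t \<in> {-1/2..1/2} \<Longrightarrow> m \<le> corr f f t"
  shows "m \<le> sqrt (2/3) * (LINT x|lborel. f x) * sqrt (LINT x|lborel. (f x)\<^sup>2)"
proof (cases "m \<le> 0")
  case True
  moreover have "0 \<le> (LINT x|lborel. f x)" "0 \<le> (LINT x|lborel. (f x)\<^sup>2)"
    using f0 by (auto intro!: integral_nonneg_AE)
  ultimately show ?thesis
    by (auto intro: order_trans[where y = 0])
next
  case False
  define A B where "A = (LINT x|lborel. (f x)\<^sup>2)" and "B = (LINT x|lborel. f x)\<^sup>2"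
  \<comment> \<open>\<open>A\<close> is the autocorrelation at 0; its positivity makes the later
    choice \<open>a = m / A\<close> legitimate.\<close>
  have "m \<le> A"
    using m[of 0] by (simp add: corr_def A_def power2_eq_square)
  have "m \<le> B"
    unfolding B_def by (rule autocorr_min_le_L1[OF assms])
  have "0 < A" "0 < B"
    using False \<open>m \<le> A\<close> \<open>m \<le> B\<close> by auto
  have "m\<^sup>2 \<le> 2/3 * (A * B)"
  \<comment> \<open>\<open>a = m / A\<close> minimises \<open>a\<^sup>2 * A - 2 * a * m\<close>.
    When it falls below the admissible 1/2, the bounds \<open>m \<le> A / 2\<close> and
    \<open>m \<le> B\<close> already give the stronger constant 1/2.\<close>
  proof (cases "1/2 \<le> m / A")
    case True
    have "m * (2 * (m / A) - 2/9) \<le> (m / A)\<^sup>2 * A + 4/9 * B"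
      using autocorr_min_quadratic[OF assms True] by (simp add: A_def B_def)
    moreover have "m * (2 * (m / A) - 2/9) = 2 * (m\<^sup>2 / A) - 2/9 * m" "(m / A)\<^sup>2 * A = m\<^sup>2 / A"
      using \<open>0 < A\<close> by (simp_all add: power2_eq_square field_simps)
    ultimately have "m\<^sup>2 / A \<le> 4/9 * B + 2/9 * m"
      by linarith
    also have "\<dots> \<le> 2/3 * B"
      using \<open>m \<le> B\<close> by simp
    finally show ?thesis
      using \<open>0 < A\<close> by (simp add: field_simps)
  next
    case False
    then have "m \<le> A / 2"
      using \<open>0 < A\<close> by (simp add: field_simps)
    then have "m * m \<le> (A / 2) * B"
      using \<open>m \<le> B\<close> \<open>\<not> m \<le> 0\<close> by (intro mult_mono) auto
    moreover have "0 < A * B"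
      using \<open>0 < A\<close> \<open>0 < B\<close> by simp
    ultimately show ?thesis
      unfolding power2_eq_square by linarith
  qed
  then have "m \<le> sqrt (2/3 * (A * B))"
    by (rule real_le_rsqrt)
  also have "\<dots> = sqrt (2/3) * (LINT x|lborel. f x) * sqrt A"
    using f0 unfolding B_def real_sqrt_mult by (simp add: integral_nonneg_AE)
  finally show ?thesis
    by (simp add: A_def)
qed

subsection \<open>Continuity of autocorrelations\<close>

lemma Cauchy_Schwarz_integral:
  fixes u v :: "'a \<Rightarrow> real"
  assumes [measurable]: "u \<in> borel_measurable M" "v \<in> borel_measurable M"
    and u2: "integrable M (\<lambda>x. (u x)\<^sup>2)" and v2: "integrable M (\<lambda>x. (v x)\<^sup>2)"
  shows "\<bar>LINT x|M. u x * v x\<bar> \<le> sqrt (LINT x|M. (u x)\<^sup>2) * sqrt (LINT x|M. (v x)\<^sup>2)"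
proof -
  have uv: "integrable M (\<lambda>x. \<bar>u x * v x\<bar>)"
    using integrable_mult_of_squares[OF assms] by simp
  have sq: "(\<integral>\<^sup>+x. (ennreal \<bar>w x\<bar>)\<^sup>2 \<partial>M) = ennreal (LINT x|M. (w x)\<^sup>2)"
    if "integrable M (\<lambda>x. (w x)\<^sup>2)" for w :: "'a \<Rightarrow> real"
    using that by (subst nn_integral_eq_integral[symmetric]) (auto simp: ennreal_power)
  have "ennreal ((LINT x|M. \<bar>u x * v x\<bar>)\<^sup>2) = (\<integral>\<^sup>+x. ennreal \<bar>u x\<bar> * ennreal \<bar>v x\<bar> \<partial>M)\<^sup>2"
    using uv by (simp add: ennreal_power[symmetric] integral_nonneg_AE nn_integral_eq_integral[symmetric]
        ennreal_mult[symmetric] abs_mult)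
  also have "\<dots> \<le> (\<integral>\<^sup>+x. (ennreal \<bar>u x\<bar>)\<^sup>2 \<partial>M) * (\<integral>\<^sup>+x. (ennreal \<bar>v x\<bar>)\<^sup>2 \<partial>M)"
    by (rule Cauchy_Schwarz_nn_integral) measurable
  also have "\<dots> = ennreal ((LINT x|M. (u x)\<^sup>2) * (LINT x|M. (v x)\<^sup>2))"
    by (simp add: sq u2 v2 ennreal_mult)
  finally have "(LINT x|M. \<bar>u x * v x\<bar>)\<^sup>2 \<le> (LINT x|M. (u x)\<^sup>2) * (LINT x|M. (v x)\<^sup>2)"
    by (simp add: ennreal_le_iff integral_nonneg_AE)
  then have "(LINT x|M. \<bar>u x * v x\<bar>) \<le> sqrt (LINT x|M. (u x)\<^sup>2) * sqrt (LINT x|M. (v x)\<^sup>2)"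
    by (simp add: real_le_rsqrt flip: real_sqrt_mult)
  with integral_abs_bound[of M "\<lambda>x. u x * v x"] show ?thesis
    by linarith
qed

text \<open>Dominated convergence turns a.e. convergence of \<open>d n\<close> into convergence in
  the 2-norm. By Cauchy-Schwarz and translation invariance the correlations then converge uniformly
  in \<open>t\<close>, which preserves continuity.\<close>

lemma continuous_corr_L2_limit:
  fixes f h :: "real \<Rightarrow> real" and d :: "nat \<Rightarrow> real \<Rightarrow> real"
  assumes [measurable]: "f \<in> borel_measurable borel" "h \<in> borel_measurable borel"
    "\<And>n. d n \<in> borel_measurable borel"
    and f2: "integrable lborel (\<lambda>x. (f x)\<^sup>2)" and h2: "integrable lborel (\<lambda>x. (h x)\<^sup>2)"
    and bound: "\<And>n x. \<bar>d n x\<bar> \<le> b x" and b2: "integrable lborel (\<lambda>x. (b x)\<^sup>2)"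
    and b [measurable]: "b \<in> borel_measurable borel"
    and lim: "AE x in lborel. (\<lambda>n. d n x) \<longlonglongrightarrow> h x"
    and cont: "\<And>n. continuous_on UNIV (corr (d n) f)"
  shows "continuous_on UNIV (corr h f)"
proof (rule uniform_limit_theorem[where F = sequentially and f = "\<lambda>n. corr (d n) f"])
  have dn_le: "(d n x)\<^sup>2 \<le> (b x)\<^sup>2" for n x
    using power_mono[OF bound, of n x 2] by simp
  have d2: "integrable lborel (\<lambda>x. (d n x)\<^sup>2)" for n
    by (rule Bochner_Integration.integrable_bound[OF b2]) (use dn_le in auto)
  have sq_le: "(h x - d n x)\<^sup>2 \<le> 2 * (h x)\<^sup>2 + 2 * (b x)\<^sup>2" for n x
  proof -
    have "(h x - d n x)\<^sup>2 \<le> 2 * (h x)\<^sup>2 + 2 * (d n x)\<^sup>2"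
      using zero_le_power2[of "h x + d n x"] by (simp add: power2_eq_square algebra_simps)
    with dn_le[of n x] show ?thesis by linarith
  qed
  have hd2: "integrable lborel (\<lambda>x. (h x - d n x)\<^sup>2)" for n
    by (rule Bochner_Integration.integrable_bound[where f = "\<lambda>x. 2 * (h x)\<^sup>2 + 2 * (b x)\<^sup>2"])
       (use h2 b2 sq_le in \<open>auto intro!: AE_I2\<close>)
  define \<epsilon> where "\<epsilon> n = sqrt (LINT x|lborel. (h x - d n x)\<^sup>2) * sqrt (LINT x|lborel. (f x)\<^sup>2)" for n
  have "(\<lambda>n. LINT x|lborel. (h x - d n x)\<^sup>2) \<longlonglongrightarrow> (LINT (x::real)|lborel. (0::real))"
  proof (rule integral_dominated_convergence[where w = "\<lambda>x. 2 * (h x)\<^sup>2 + 2 * (b x)\<^sup>2"])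
    show "AE x in lborel. (\<lambda>n. (h x - d n x)\<^sup>2) \<longlonglongrightarrow> 0"
      using lim by eventually_elim (auto intro!: tendsto_eq_intros)
  qed (use h2 b2 sq_le in auto)
  then have "\<epsilon> \<longlonglongrightarrow> sqrt 0 * sqrt (LINT x|lborel. (f x)\<^sup>2)"
    unfolding \<epsilon>_def by (intro tendsto_intros) simp
  then have \<epsilon>: "\<epsilon> \<longlonglongrightarrow> 0" by simp
  have close: "\<bar>corr (d n) f t - corr h f t\<bar> \<le> \<epsilon> n" for n t
  proof -
    have ft2: "integrable lborel (\<lambda>x. (f (x + t))\<^sup>2)"
      using integrable_lborel_shift[OF f2] .
    have "corr h f t - corr (d n) f t = (LINT x|lborel. (h x - d n x) * f (x + t))"
      unfolding corr_def left_diff_distrib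
      by (intro Bochner_Integration.integral_diff[symmetric] integrable_mult_of_squares h2 d2 ft2) measurable
    also have "\<bar>\<dots>\<bar> \<le> sqrt (LINT x|lborel. (h x - d n x)\<^sup>2) * sqrt (LINT x|lborel. (f (x + t))\<^sup>2)"
      by (intro Cauchy_Schwarz_integral hd2 ft2) measurable
    also have "\<dots> = \<epsilon> n"
      unfolding \<epsilon>_def using integral_lborel_shift[of "\<lambda>x. (f x)\<^sup>2" t] by simp
    finally show ?thesis by (simp add: abs_minus_commute)
  qed
  show "uniform_limit UNIV (\<lambda>n. corr (d n) f) (corr h f) sequentially"
  proof (rule uniform_limitI)
    fix e :: real assume "0 < e"
    with \<epsilon> have "\<forall>\<^sub>F n in sequentially. \<epsilon> n < e"
      by (rule order_tendstoD)
    then show "\<forall>\<^sub>F n in sequentially. \<forall>t\<in>UNIV. dist (corr (d n) f t) (corr h f t) < e"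
      by eventually_elim (use close in \<open>auto simp: dist_real_def intro: le_less_trans\<close>)
  qed
qed (use cont in auto)

text \<open>A translation moves the shift onto the continuous factor \<open>c\<close>; dominated
  convergence with bound \<open>K * \<bar>f x\<bar>\<close> finishes.\<close>

lemma continuous_corr_bounded_continuous:
  fixes f c :: "real \<Rightarrow> real"
  assumes f: "integrable lborel f" and c: "continuous_on UNIV c" and K: "\<And>x. \<bar>c x\<bar> \<le> K"
  shows "continuous_on UNIV (corr c f)"
proof -
  have [measurable]: "f \<in> borel_measurable borel" "c \<in> borel_measurable borel"
    using f c by (auto intro: borel_measurable_continuous_onI)
  have eq: "corr c f t = (LINT x|lborel. c (x - t) * f x)" for t
    using integral_lborel_shift[of "\<lambda>x. c (x - t) * f x" t] by (simp add: corr_def)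
  have "corr c f \<midarrow>t\<rightarrow> corr c f t" for t
    unfolding tendsto_at_iff_sequentially comp_def eq
  proof (intro allI impI)
    fix s :: "nat \<Rightarrow> real" assume s: "s \<longlonglongrightarrow> t"
    have *: "isCont c y" for y
      using c by (simp add: continuous_on_eq_continuous_at)
    show "(\<lambda>n. LINT x|lborel. c (x - s n) * f x) \<longlonglongrightarrow> (LINT x|lborel. c (x - t) * f x)"
    proof (rule integral_dominated_convergence[where w = "\<lambda>x. K * \<bar>f x\<bar>"])
      show "AE x in lborel. (\<lambda>n. c (x - s n) * f x) \<longlonglongrightarrow> c (x - t) * f x"
        using s by (intro AE_I2 tendsto_intros isCont_tendsto_compose[OF *])
      show "AE x in lborel. norm (c (x - s n) * f x) \<le> K * \<bar>f x\<bar>" for n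
        using K by (auto simp: abs_mult intro!: mult_right_mono)
    qed (use f in auto)
  qed
  then show ?thesis
    by (simp add: continuous_on_eq_continuous_at isCont_def)
qed

definition clip :: "real \<Rightarrow> real \<Rightarrow> real" where
  "clip K y = max (- K) (min K y)"

text \<open>A continuous substitute for the indicator of \<open>{-K..K}\<close>, falling linearly to
  0 over unit length on either side, so that products with continuous functions stay
  continuous.\<close>

definition cutoff :: "real \<Rightarrow> real \<Rightarrow> real" where
  "cutoff K x = max 0 (min 1 (K + 1 - \<bar>x\<bar>))"

lemma continuous_autocorr:
  fixes f :: "real \<Rightarrow> real"
  assumes f1: "integrable lborel f" and f2: "integrable lborel (\<lambda>x. (f x)\<^sup>2)"
  shows "continuous_on UNIV (corr f f)"
proof -
  have [measurable]: "f \<in> borel_measurable borel"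
    using f1 by auto
  \<comment> \<open>\<open>f\<close> is an a.e. limit of continuous functions; clipping and cutting these off keeps them
    continuous and dominated, so the a.e. convergence becomes \<open>L\<^sup>2\<close> convergence.\<close>
  have "f measurable_on UNIV"
    by (simp add: measurable_on_iff_borel_measurable measurable_completion measurable_restrict_space1)
  then obtain N c where N: "negligible N" and c: "\<And>n. continuous_on UNIV (c n)"
    and lim: "\<And>x. x \<notin> N \<Longrightarrow> (\<lambda>n. c n x) \<longlonglongrightarrow> f x"
    unfolding measurable_on_def by auto
  have [measurable]: "c n \<in> borel_measurable borel" for n
    using c by (rule borel_measurable_continuous_onI)
  have "AE x in lebesgue. x \<notin> N"
    using N by (auto simp: negligible_iff_null_sets intro: AE_not_in)
  then have AE: "AE x in lborel. (\<lambda>n. c n x) \<longlonglongrightarrow> f x"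
    unfolding AE_completion_iff by eventually_elim (rule lim)
  define F where "F n x = cutoff (real n) x * clip (real n) (f x)" for n x
  \<comment> \<open>First stage, with \<open>K\<close> fixed: the truncated \<open>c n\<close>
    converge a.e. to the truncated \<open>f\<close>, and all are dominated by a multiple of one
    interval indicator.\<close>
  have cont: "continuous_on UNIV (corr (\<lambda>x. cutoff K x * clip K (f x)) f)" if "0 \<le> K" for K :: real
  proof (rule continuous_corr_L2_limit[where d = "\<lambda>n x. cutoff K x * clip K (c n x)"
        and b = "\<lambda>x. K * indicator {-(K + 1)..K + 1} x"])
    show "(\<lambda>x. cutoff K x * clip K (f x)) \<in> borel_measurable borel" "\<And>n. (\<lambda>x. cutoff K x * clip K (c n x)) \<in> borel_measurable borel"
      unfolding cutoff_def clip_def by measurable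
    show bound: "\<bar>cutoff K x * clip K y\<bar> \<le> K * indicator {-(K + 1)..K + 1} x" for x y :: real
    proof -
      have "\<bar>cutoff K x\<bar> \<le> indicator {-(K + 1)..K + 1} x" "\<bar>clip K y\<bar> \<le> K"
        using that by (auto simp: cutoff_def clip_def indicator_def)
      then show ?thesis
        unfolding abs_mult using that by (subst mult.commute) (intro mult_mono, auto)
    qed
    show b2: "integrable lborel (\<lambda>x. (K * indicator {-(K + 1)..K + 1} x :: real)\<^sup>2)"
    proof -
      have "(\<lambda>x. (K * indicator {-(K + 1)..K + 1} x)\<^sup>2) = (\<lambda>x. K\<^sup>2 * indicator {-(K + 1)..K + 1} x)"
        by (auto simp: indicator_def)
      moreover have "integrable lborel (\<lambda>x. K\<^sup>2 * indicator {-(K + 1)..K + 1} x)"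
        by (intro integrable_mult_right integrable_real_indicator) (simp_all add: emeasure_lborel_Icc_eq)
      ultimately show ?thesis
        by simp
    qed
    show "integrable lborel (\<lambda>x. (cutoff K x * clip K (f x))\<^sup>2)"
    proof (rule Bochner_Integration.integrable_bound[OF b2])
      show "AE x in lborel. norm ((cutoff K x * clip K (f x))\<^sup>2) \<le> norm ((K * indicator {-(K + 1)..K + 1} x :: real)\<^sup>2)"
        using power_mono[OF bound abs_ge_zero, of _ _ 2] by (auto)
    qed (simp add: cutoff_def clip_def)
    show "AE x in lborel. (\<lambda>n. cutoff K x * clip K (c n x)) \<longlonglongrightarrow> cutoff K x * clip K (f x)"
      using AE unfolding clip_def by eventually_elim (intro tendsto_intros)
    show "continuous_on UNIV (corr (\<lambda>x. cutoff K x * clip K (c n x)) f)" for n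
    proof (rule continuous_corr_bounded_continuous[OF f1])
      show "continuous_on UNIV (\<lambda>x. cutoff K x * clip K (c n x))"
        unfolding cutoff_def clip_def using c by (intro continuous_intros)
      show "\<bar>cutoff K x * clip K (c n x)\<bar> \<le> K" for x
        using bound[of x "c n x"] that by (cases "x \<in> {-(K + 1)..K + 1}") auto
    qed
  qed (use f2 in auto)
  have Fc: "continuous_on UNIV (corr (F n) f)" for n
    using cont[of n] by (simp add: F_def[abs_def])
  \<comment> \<open>Second stage: the truncation level grows. At each point \<open>F n\<close>
    eventually equals \<open>f\<close>, and \<open>\<bar>f x\<bar>\<close> dominates
    throughout.\<close>
  show ?thesis
  proof (rule continuous_corr_L2_limit[where d = F and b = "\<lambda>x. \<bar>f x\<bar>"])
    show "\<And>n. F n \<in> borel_measurable borel"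
      unfolding F_def cutoff_def clip_def by measurable
    show "\<bar>F n x\<bar> \<le> \<bar>f x\<bar>" for n x
    proof -
      have "\<bar>cutoff n x\<bar> * \<bar>clip n (f x)\<bar> \<le> 1 * \<bar>f x\<bar>"
        by (intro mult_mono) (auto simp: cutoff_def clip_def)
      then show ?thesis by (simp add: F_def abs_mult)
    qed
    have "(\<lambda>n. F n x) \<longlonglongrightarrow> f x" for x
    proof (rule tendsto_eventually)
      obtain n0 :: nat where "\<bar>x\<bar> + \<bar>f x\<bar> \<le> n0"
        using real_arch_simple by blast
      then have "F n x = f x" if "n0 \<le> n" for n
        using that of_nat_mono[OF that, where 'a = real] by (auto simp: F_def cutoff_def clip_def)
      then show "\<forall>\<^sub>F n in sequentially. F n x = f x"
        by (auto simp: eventually_sequentially)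
    qed
    then show "AE x in lborel. (\<lambda>n. F n x) \<longlonglongrightarrow> f x"
      by simp
  qed (use f2 Fc in auto)
qed

subsection \<open>Reduction to Borel functions and the example\<close>

text \<open>The Tonelli arguments work with Borel functions on \<open>lborel\<close>. An a.e. equal
  Borel representative changes neither the norms nor any value of the autocorrelation.\<close>

lemma Lp_1_2_borel_version:
  assumes "f \<in> Lp 1 \<inter> Lp 2"
  obtains h where "h \<in> borel_measurable borel" "integrable lborel h" "integrable lborel (\<lambda>x. (h x)\<^sup>2)"
    "autocorr f = corr h h" "Lp_norm 1 f = (LINT x|lborel. \<bar>h x\<bar>)" "Lp_norm 2 f = sqrt (LINT x|lborel. (h x)\<^sup>2)"
proof -
  have f [measurable]: "f \<in> borel_measurable lebesgue"
    and i1: "integrable lebesgue (\<lambda>x. \<bar>f x\<bar>)" and i2: "integrable lebesgue (\<lambda>x. (f x)\<^sup>2)"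
    using assms by (auto simp: Lp_def)
  obtain h where h [measurable]: "h \<in> borel_measurable borel" and AE: "AE x in lborel. f x = h x"
    using completion_ex_borel_measurable_real[OF f] by auto
  have h' [measurable]: "h \<in> borel_measurable lebesgue"
    using h by (simp add: measurable_completion)
  have AE': "AE x in lebesgue. f x = h x"
    using AE by (rule AE_completion)
  \<comment> \<open>A translate of the exceptional null set is again null.\<close>
  have AEt: "AE x in lebesgue. f (x + t) = h (x + t)" for t
  proof -
    obtain N where N: "N \<in> null_sets lborel" "{x. f x \<noteq> h x} \<subseteq> N"
      using AE unfolding eventually_ae_filter by auto
    then have "AE x in lborel. t + 1 * x \<notin> N"
      by (intro AE_borel_affine AE_not_in) (auto simp: null_sets_def)
    then have "AE x in lborel. f (x + t) = h (x + t)"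
      by eventually_elim (use N in \<open>auto simp: add.commute\<close>)
    then show ?thesis by (rule AE_completion)
  qed
  have "autocorr f t = corr h h t" for t
  proof -
    have "autocorr f t = (LINT x|lebesgue. h x * h (x + t))"
      unfolding autocorr_def
    proof (rule integral_cong_AE)
      show *: "AE x in lebesgue. f x * f (x + t) = h x * h (x + t)"
        using AE' AEt[of t] by eventually_elim simp
      show hh: "(\<lambda>x. h x * h (x + t)) \<in> borel_measurable lebesgue"
        by (rule measurable_completion) simp
      \<comment> \<open>Completeness of \<open>lebesgue\<close> passes measurability from the Borel
        product to this a.e. equal one.\<close>
      show "(\<lambda>x. f x * f (x + t)) \<in> borel_measurable lebesgue"
        by (rule borel_measurable_AE[OF hh]) (use * in \<open>auto elim: eventually_mono\<close>)
    qed
    then show ?thesis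
      by (simp add: corr_def integral_completion)
  qed
  moreover have "integrable lborel h" "integrable lborel (\<lambda>x. (h x)\<^sup>2)"
  proof -
    have "integrable lebesgue (\<lambda>x. \<bar>h x\<bar>)"
      by (rule integrable_cong_AE_imp[OF i1]) (use AE' in auto)
    then show "integrable lborel h" by (simp add: integrable_completion integrable_abs_iff)
    have "integrable lebesgue (\<lambda>x. (h x)\<^sup>2)"
      by (rule integrable_cong_AE_imp[OF i2]) (use AE' in auto)
    then show "integrable lborel (\<lambda>x. (h x)\<^sup>2)" by (simp add: integrable_completion)
  qed
  moreover have "(LINT x|lebesgue. \<bar>f x\<bar>) = (LINT x|lborel. \<bar>h x\<bar>)"
  proof -
    have "(LINT x|lebesgue. \<bar>f x\<bar>) = (LINT x|lebesgue. \<bar>h x\<bar>)"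
      by (rule integral_cong_AE) (use AE' in auto)
    then show ?thesis by (simp add: integral_completion)
  qed
  moreover have "(LINT x|lebesgue. (f x)\<^sup>2) = (LINT x|lborel. (h x)\<^sup>2)"
  proof -
    have "(LINT x|lebesgue. (f x)\<^sup>2) = (LINT x|lebesgue. (h x)\<^sup>2)"
      by (rule integral_cong_AE) (use AE' in auto)
    then show ?thesis by (simp add: integral_completion)
  qed
  ultimately show thesis
    using that[of h] h by (auto simp: fun_eq_iff Lp_norm_def powr_half_sqrt integral_nonneg_AE)
qed

lemma autocorr_min_exists:
  assumes "f \<in> Lp 1 \<inter> Lp 2"
  obtains m where "is_min_on (autocorr f) {-1/2..1/2} m"
    "m \<le> sqrt (2/3) * Lp_norm 1 f * Lp_norm 2 f"
proof -
  obtain h where h [measurable]: "h \<in> borel_measurable borel"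
    and h1: "integrable lborel h" and h2: "integrable lborel (\<lambda>x. (h x)\<^sup>2)"
    and eq: "autocorr f = corr h h" "Lp_norm 1 f = (LINT x|lborel. \<bar>h x\<bar>)"
      "Lp_norm 2 f = sqrt (LINT x|lborel. (h x)\<^sup>2)"
    using assms by (rule Lp_1_2_borel_version)
  have "continuous_on {-1/2..1/2} (corr h h)"
    using continuous_autocorr[OF h1 h2] by (rule continuous_on_subset) simp
  then obtain s where s: "s \<in> {-1/2..1/2}" "\<And>t. t \<in> {-1/2..1/2} \<Longrightarrow> corr h h s \<le> corr h h t"
    using continuous_attains_inf[of "{-1/2..1/2::real}" "corr h h"] by auto
  \<comment> \<open>Passing to \<open>\<bar>h x\<bar>\<close> keeps both norms and cannot lower the
    autocorrelation, so the minimum for \<open>h\<close> is a lower bound for the nonnegative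
    function.\<close>
  have abs_le: "corr h h t \<le> corr (\<lambda>x. \<bar>h x\<bar>) (\<lambda>x. \<bar>h x\<bar>) t" for t
    unfolding corr_def
    using integral_abs_bound[of lborel "\<lambda>x. h x * h (x + t)"] by (simp add: abs_mult)
  have "corr h h s \<le> sqrt (2/3) * (LINT x|lborel. \<bar>h x\<bar>) * sqrt (LINT x|lborel. \<bar>h x\<bar>\<^sup>2)"
    by (rule nonneg_autocorr_min_le) (use h1 h2 s abs_le in \<open>auto intro: order_trans\<close>)
  then show thesis
    using that[of "corr h h s"] s by (auto simp: is_min_on_def eq)
qed

text \<open>For an interval of length \<open>L \<ge> 1/2\<close> the minimum is
  \<open>L - 1/2\<close>, attained at the endpoints, and the product of the norms is
  \<open>L powr (3/2)\<close>. The quotient is largest at \<open>L = 3/2\<close>.\<close>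

lemma autocorr_interval_indicator:
  fixes f :: "real \<Rightarrow> real"
  defines "f \<equiv> indicator {-(3/4)..3/4}"
  shows "f \<in> Lp 1 \<inter> Lp 2" "is_min_on (autocorr f) {-1/2..1/2} 1"
    "Lp_norm 1 f = 3/2" "Lp_norm 2 f = sqrt (3/2)"
proof -
  have f: "has_bochner_integral lborel f (3/2)"
    unfolding f_def using has_bochner_integral_real_indicator[of "{-(3/4)..3/4::real}" lborel] by simp
  have f' [measurable]: "f \<in> borel_measurable borel"
    by (simp add: f_def)
  \<comment> \<open>Valid for every \<open>p\<close>, because \<open>f\<close> takes only the values
    0 and 1 and \<open>0 powr p = 0\<close>.\<close>
  have pow: "\<bar>f x\<bar> powr p = f x" for x p
    by (auto simp: f_def indicator_def)
  have int: "integrable lebesgue f" "(LINT x|lebesgue. f x) = 3/2"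
    using f by (simp_all add: integrable_completion integral_completion has_bochner_integral_iff)
  then show "f \<in> Lp 1 \<inter> Lp 2" "Lp_norm 1 f = 3/2" "Lp_norm 2 f = sqrt (3/2)"
    unfolding Lp_def Lp_norm_def Int_iff mem_Collect_eq pow by (auto simp: powr_half_sqrt measurable_completion)
  have "autocorr f t = 3/2 - \<bar>t\<bar>" if "t \<in> {-1/2..1/2}" for t
  proof -
    have "autocorr f t = (LINT x|lborel. f x * f (x + t))"
      unfolding autocorr_def by (rule integral_completion) simp
    also have "\<dots> = max 0 (min (3/4) (3/4 - t) - max (-(3/4)) (-(3/4) - t))"
      using has_bochner_integral_overlap[of "3/4" "3/4" t]
      by (simp add: f_def has_bochner_integral_iff)
    also have "\<dots> = 3/2 - \<bar>t\<bar>"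
      using that by (auto simp: max_def min_def abs_if)
    finally show ?thesis .
  qed
  then show "is_min_on (autocorr f) {-1/2..1/2} 1"
    by (auto simp: is_min_on_def image_iff intro!: bexI[of _ "1/2"])
qed

theorem theorem1p3:
  "(\<forall>f \<in> Lp 1 \<inter> Lp 2. \<exists>m. is_min_on (autocorr f) {-1/2..1/2} m \<and>
      m \<le> 0.829604 * Lp_norm 1 f * Lp_norm 2 f) \<and>
   (\<exists>f \<in> Lp 1 \<inter> Lp 2. \<exists>m. is_min_on (autocorr f) {-1/2..1/2} m \<and>
      \<not> m \<le> 0.544 * Lp_norm 1 f * Lp_norm 2 f)"
proof (intro conjI ballI)
  fix f assume f: "f \<in> Lp 1 \<inter> Lp 2"
  obtain m where m: "is_min_on (autocorr f) {-1/2..1/2} m"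
    "m \<le> sqrt (2/3) * Lp_norm 1 f * Lp_norm 2 f"
    using f by (rule autocorr_min_exists)
  \<comment> \<open>The left side is about 0.8165.\<close>
  have "sqrt (2/3) \<le> (0.829604 :: real)"
    by (rule real_le_lsqrt) (simp_all add: power2_eq_square)
  then have "sqrt (2/3) * Lp_norm 1 f * Lp_norm 2 f \<le> 0.829604 * Lp_norm 1 f * Lp_norm 2 f"
    by (intro mult_right_mono) (simp_all add: Lp_norm_def)
  with m show "\<exists>m. is_min_on (autocorr f) {-1/2..1/2} m \<and> m \<le> 0.829604 * Lp_norm 1 f * Lp_norm 2 f"
    by (meson order_trans)
next
  \<comment> \<open>The margin is narrow: 0.544 * 1.5 * 1.225 = 0.9996.\<close>
  have "sqrt (3/2) \<le> (1.225 :: real)"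
    by (rule real_le_lsqrt) (simp_all add: power2_eq_square)
  then have "\<not> 1 \<le> 0.544 * (3/2) * sqrt (3/2 :: real)"
    by simp
  then show "\<exists>f \<in> Lp 1 \<inter> Lp 2. \<exists>m. is_min_on (autocorr f) {-1/2..1/2} m \<and>
      \<not> m \<le> 0.544 * Lp_norm 1 f * Lp_norm 2 f"
    by (intro bexI[of _ "indicator {-(3/4)..3/4}"] exI[of _ 1] conjI)
      (simp_all only: autocorr_interval_indicator not_False_eq_True)
qed

end
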